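(* Let $s:[1,\infty)\to\mathbb{C}$ be a function with $s\in L_{\rm loc}[1,\infty)$, and suppose that $s$ is summable $(L,1)$ to some $A\in\mathbb{C}$. Then the ordinary limit $\lim_{t\to\infty}s(t)=A$ exists if and only if $$\liminf_{\lambda\to 1+}\ \limsup_{t\to\infty}\ \left|\frac{1}{(\lambda-1)\log t}\int_t^{t^\lambda}\frac{s(u)-s(t)}{u}\,du\right|=0.$$
   Context: $L_{\rm loc}[1,\infty)$ denotes the set of functions on $[1,\infty)$ that are Lebesgue integrable on every bounded interval $[1,t]$, $t>1$. A function $s\in L_{\rm loc}[1,\infty)$ is an actual (everywhere defined) function. It is called summable $(L,1)$ to $A$ if $\lim_{t\to\infty}\tau(t)=A$, where $\tau(t):=\frac{1}{\log t}\int_1^t\frac{s(u)}{u}\,du$ for $t>1$, with $\log$ the natural logarithm. *)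

theory Defs
  imports "HOL-Analysis.Analysis"
begin

text \<open>
  Functions on \<open>[1, \<infinity>)\<close> are represented by total functions on the reals; the
  values at arguments below 1 are irrelevant to every notion in this theory.
  Integrability and integrals are with respect to the (complete) Lebesgue measure.
\<close>

definition L_loc :: "(real \<Rightarrow> complex) set" where
  "L_loc = {s. \<forall>t>1. set_integrable lebesgue {1..t} s}"

definition log_mean :: "(real \<Rightarrow> complex) \<Rightarrow> real \<Rightarrow> complex" where
  "log_mean s t =
     complex_of_real (1 / ln t) * (LINT u:{1..t}|lebesgue. s u / complex_of_real u)"

definition summable_L1 :: "(real \<Rightarrow> complex) \<Rightarrow> complex \<Rightarrow> bool" where
  "summable_L1 s A \<longleftrightarrow> (log_mean s \<longlongrightarrow> A) at_top"

end

theory Submission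
  imports Defs
begin

text \<open>
  For fixed \<open>\<lambda> > 1\<close> the integral of \<open>s(u)/u\<close> over \<open>[t, t\<^sup>\<lambda>]\<close> equals
  \<open>\<lambda> ln t \<tau>(t\<^sup>\<lambda>) - ln t \<tau>(t)\<close>, where \<open>\<tau>\<close> is the logarithmic mean, so the averaged
  difference in the criterion is \<open>(\<lambda> \<tau>(t\<^sup>\<lambda>) - \<tau>(t)) / (\<lambda> - 1) - s(t) = A - s(t) + o(1)\<close>
  as \<open>t\<close> tends to infinity. Hence the limes superior is that of \<open>|s(t) - A|\<close> for
  every \<open>\<lambda> > 1\<close>, and the limes inferior over \<open>\<lambda>\<close> is taken over a constant.
\<close>

text \<open>By the triangle inequality the norm of \<open>f\<close> is eventually at most that of
  \<open>g\<close> plus \<open>e\<close>, for each \<open>e > 0\<close>. The limes superior is taken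
  in \<open>ereal\<close>, so it may be infinite and no boundedness of \<open>f\<close> or
  \<open>g\<close> enters.\<close>

lemma Limsup_norm_le_of_diff_tendsto_0:
  fixes f g :: "'a \<Rightarrow> 'b::real_normed_vector"
  assumes "F \<noteq> bot" and "((\<lambda>x. f x - g x) \<longlongrightarrow> 0) F"
  shows "Limsup F (\<lambda>x. ereal (norm (f x))) \<le> Limsup F (\<lambda>x. ereal (norm (g x)))"
proof (rule ereal_le_epsilon2)
  fix e :: real assume "e > 0"
  have "\<forall>\<^sub>F x in F. norm (f x - g x) < e"
    using tendstoD[OF assms(2) \<open>e > 0\<close>] by simp
  then have "\<forall>\<^sub>F x in F. ereal (norm (f x)) \<le> ereal (norm (g x)) + ereal e"
  proof eventually_elim
    case (elim x)
    then show ?case using norm_triangle_ineq2[of "f x" "g x"] by simp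
  qed
  then have "Limsup F (\<lambda>x. ereal (norm (f x))) \<le> Limsup F (\<lambda>x. ereal (norm (g x)) + ereal e)"
    by (rule Limsup_mono)
  \<comment> \<open>The constant \<open>e\<close> is finite, so it can be pulled out even when the
    limes superior is infinite.\<close>
  also have "\<dots> = Limsup F (\<lambda>x. ereal (norm (g x))) + ereal e"
    using assms(1) by (intro Limsup_add_ereal_right) auto
  finally show "Limsup F (\<lambda>x. ereal (norm (f x))) \<le> Limsup F (\<lambda>x. ereal (norm (g x))) + ereal e" .
qed

lemma Limsup_norm_eq_of_diff_tendsto_0:
  fixes f g :: "'a \<Rightarrow> 'b::real_normed_vector"
  assumes "F \<noteq> bot" and "((\<lambda>x. f x - g x) \<longlongrightarrow> 0) F"
  shows "Limsup F (\<lambda>x. ereal (norm (f x))) = Limsup F (\<lambda>x. ereal (norm (g x)))"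
proof (rule antisym)
  have "((\<lambda>x. g x - f x) \<longlongrightarrow> 0) F"
    using tendsto_minus[OF assms(2)] by simp
  then show "Limsup F (\<lambda>x. ereal (norm (g x))) \<le> Limsup F (\<lambda>x. ereal (norm (f x)))"
    by (rule Limsup_norm_le_of_diff_tendsto_0[OF assms(1)])
qed (rule Limsup_norm_le_of_diff_tendsto_0[OF assms])

text \<open>Norms are nonnegative, so a vanishing limes superior squeezes the limes inferior to 0 as
  well, and the two together give convergence.\<close>

lemma Limsup_norm_eq_0_iff:
  fixes f :: "'a \<Rightarrow> 'b::real_normed_vector"
  assumes "F \<noteq> bot"
  shows "Limsup F (\<lambda>x. ereal (norm (f x))) = 0 \<longleftrightarrow> (f \<longlongrightarrow> 0) F"
proof
  assume L: "Limsup F (\<lambda>x. ereal (norm (f x))) = 0"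
  have "0 \<le> Liminf F (\<lambda>x. ereal (norm (f x)))"
    by (rule Liminf_bounded) simp
  with L Liminf_le_Limsup[OF assms, of "\<lambda>x. ereal (norm (f x))"]
  have "Liminf F (\<lambda>x. ereal (norm (f x))) = 0" by simp
  with L have "((\<lambda>x. ereal (norm (f x))) \<longlongrightarrow> ereal 0) F"
    by (simp add: tendsto_iff_Liminf_eq_Limsup[OF assms] flip: zero_ereal_def)
  then show "(f \<longlongrightarrow> 0) F"
    by (simp only: lim_ereal tendsto_norm_zero_iff)
next
  assume "(f \<longlongrightarrow> 0) F"
  then have "((\<lambda>x. ereal (norm (f x))) \<longlongrightarrow> ereal 0) F"
    by (simp only: lim_ereal tendsto_norm_zero_iff)
  then show "Limsup F (\<lambda>x. ereal (norm (f x))) = 0"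
    unfolding zero_ereal_def by (rule lim_imp_Limsup[OF assms])
qed

text \<open>Since \<open>a > 0\<close>, the factor \<open>inverse\<close> is continuous on a compact
  interval, hence bounded and measurable there, and multiplying by it preserves
  integrability.\<close>

lemma set_integrable_divide_of_real:
  fixes f :: "real \<Rightarrow> complex"
  assumes f: "set_integrable lebesgue {a..b} f" and "a > 0"
  shows "set_integrable lebesgue {a..b} (\<lambda>u. f u / complex_of_real u)"
proof -
  have c: "continuous_on {a..b} (inverse :: real \<Rightarrow> real)"
    using \<open>a > 0\<close> by (intro continuous_intros) auto
  have "(\<lambda>u. inverse u *\<^sub>R f u) absolutely_integrable_on {a..b}"
  proof (rule absolutely_integrable_bounded_measurable_product
        [where h = scaleR and f = inverse, OF _ _ _ _ f])
    show "bilinear (scaleR :: real \<Rightarrow> complex \<Rightarrow> complex)"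
      using bounded_bilinear_scaleR bilinear_conv_bounded_bilinear by blast
    show "inverse \<in> borel_measurable (lebesgue_on {a..b})"
      by (rule continuous_imp_measurable_on_sets_lebesgue[OF c]) simp
    show "bounded (inverse ` {a..b})"
      by (intro compact_imp_bounded compact_continuous_image c compact_Icc)
  qed simp
  then show ?thesis
    by (simp add: scaleR_conv_of_real divide_inverse mult.commute)
qed

lemma set_lebesgue_integral_combine_Icc:
  fixes f :: "real \<Rightarrow> complex"
  assumes "set_integrable lebesgue {a..b} f" and "a \<le> c" "c \<le> b"
  shows "(LINT u:{a..c}|lebesgue. f u) + (LINT u:{c..b}|lebesgue. f u)
    = (LINT u:{a..b}|lebesgue. f u)"
proof -
  have "set_integrable lebesgue {a..c} f" "set_integrable lebesgue {c..b} f"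
    using assms by (auto intro: set_integrable_subset)
  with assms show ?thesis
    by (simp add: set_lebesgue_integral_eq_integral Henstock_Kurzweil_Integration.integral_combine)
qed

text \<open>Applied with \<open>c = s t\<close>: the value at the left endpoint is constant in the
  variable of integration. The antiderivative is \<open>c\<close> times the logarithm.\<close>

lemma set_lebesgue_integral_const_divide:
  fixes c :: complex
  assumes "0 < a" "a \<le> b"
  shows "set_integrable lebesgue {a..b} (\<lambda>u. c / complex_of_real u)"
    and "(LINT u:{a..b}|lebesgue. c / complex_of_real u) = c * complex_of_real (ln b - ln a)"
proof -
  have "continuous_on {a..b} (\<lambda>u. c / complex_of_real u)"
    using assms by (intro continuous_intros) auto
  then show i: "set_integrable lebesgue {a..b} (\<lambda>u. c / complex_of_real u)"
    by (rule absolutely_integrable_continuous_real)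
  have "((\<lambda>u. c / complex_of_real u) has_integral
      c * complex_of_real (ln b) - c * complex_of_real (ln a)) {a..b}"
  proof (rule fundamental_theorem_of_calculus[OF \<open>a \<le> b\<close>])
    fix u assume "u \<in> {a..b}"
    with assms have u: "u > 0" by simp
    show "((\<lambda>u. c * complex_of_real (ln u)) has_vector_derivative c / complex_of_real u)
        (at u within {a..b})"
      using u by (auto intro!: derivative_eq_intros has_vector_derivative_mult_right
          has_vector_derivative_of_real simp: divide_inverse
          simp flip: has_real_derivative_iff_has_vector_derivative)
  qed
  then show "(LINT u:{a..b}|lebesgue. c / complex_of_real u) = c * complex_of_real (ln b - ln a)"
    using set_lebesgue_integral_eq_integral(2)[OF i]
    by (simp add: integral_unique algebra_simps)
qed

text \<open>The integral over \<open>{t..t powr l}\<close> is a difference of two integrals starting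
  at 1, each a logarithm times a mean. As \<open>ln (t powr l) = l * ln t\<close>, the constant
  \<open>s t\<close> contributes \<open>(l - 1) * ln t * s t\<close>, which the normalising factor
  reduces to \<open>s t\<close>.\<close>

lemma log_average_diff_eq:
  assumes s: "s \<in> L_loc" and t: "t > 1" and l: "l > 1"
  shows "complex_of_real (1 / ((l - 1) * ln t)) *
      (LINT u:{t..t powr l}|lebesgue. (s u - s t) / complex_of_real u)
    = (complex_of_real l * log_mean s (t powr l) - log_mean s t) / complex_of_real (l - 1) - s t"
proof -
  let ?T = "t powr l"
  have tT: "t \<le> ?T" using powr_mono[of 1 l t] t l by simp
  have lnT: "ln ?T = l * ln t" using t by (simp add: ln_powr)
  have i: "set_integrable lebesgue {1..?T} (\<lambda>u. s u / complex_of_real u)"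
    using s t tT by (intro set_integrable_divide_of_real) (auto simp: L_loc_def)
  have it: "set_integrable lebesgue {t..?T} (\<lambda>u. s u / complex_of_real u)"
    by (rule set_integrable_subset[OF i]) (use t in auto)
  have pos: "ln t > 0" using t by simp
  have lm: "(LINT u:{1..x}|lebesgue. s u / complex_of_real u) = complex_of_real (ln x) * log_mean s x"
    if "x > 1" for x using that by (simp add: log_mean_def)
  have "(LINT u:{t..?T}|lebesgue. (s u - s t) / complex_of_real u)
      = (LINT u:{t..?T}|lebesgue. s u / complex_of_real u)
        - (LINT u:{t..?T}|lebesgue. s t / complex_of_real u)"
    unfolding diff_divide_distrib
    using t tT by (intro set_integral_diff it set_lebesgue_integral_const_divide) auto
  also have "(LINT u:{t..?T}|lebesgue. s u / complex_of_real u)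
      = complex_of_real (ln ?T) * log_mean s ?T - complex_of_real (ln t) * log_mean s t"
    using set_lebesgue_integral_combine_Icc[OF i, of t] t tT by (simp add: lm algebra_simps)
  also have "(LINT u:{t..?T}|lebesgue. s t / complex_of_real u)
      = s t * complex_of_real (ln ?T - ln t)"
    using t tT by (intro set_lebesgue_integral_const_divide) auto
  finally have "(LINT u:{t..?T}|lebesgue. (s u - s t) / complex_of_real u)
      = complex_of_real (ln t) * (complex_of_real l * log_mean s ?T - log_mean s t
          - complex_of_real (l - 1) * s t)"
    by (simp add: lnT algebra_simps)
  moreover have "complex_of_real (ln t) \<noteq> 0" "complex_of_real (l - 1) \<noteq> 0"
    using pos l by (simp_all only: of_real_eq_0_iff)
  ultimately show ?thesis
    by (simp only: of_real_divide of_real_mult of_real_1) (simp add: field_simps)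
qed

lemma log_average_diff_tendsto:
  assumes s: "s \<in> L_loc" and A: "summable_L1 s A" and l: "l > 1"
  shows "((\<lambda>t. complex_of_real (1 / ((l - 1) * ln t)) *
      (LINT u:{t..t powr l}|lebesgue. (s u - s t) / complex_of_real u) - (A - s t)) \<longlongrightarrow> 0) at_top"
proof -
  have \<tau>: "(log_mean s \<longlongrightarrow> A) at_top" using A by (simp add: summable_L1_def)
  have "filterlim (\<lambda>t::real. t powr l) at_top at_top"
  proof (rule filterlim_at_top_mono[OF filterlim_ident])
    show "\<forall>\<^sub>F t::real in at_top. t \<le> t powr l"
      using eventually_ge_at_top[of 1]
    proof eventually_elim
      case (elim t)
      then show ?case using powr_mono[of 1 l t] l by simp
    qed
  qed
  then have \<tau>l: "((\<lambda>t. log_mean s (t powr l)) \<longlongrightarrow> A) at_top"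
    by (rule filterlim_compose[OF \<tau>])
  have l0: "complex_of_real (l - 1) \<noteq> 0" using l by (simp only: of_real_eq_0_iff)
  \<comment> \<open>Both means tend to \<open>A\<close>, with weights \<open>l\<close> and
    \<open>-1\<close> that sum to \<open>l - 1\<close>, so the quotient tends to
    \<open>A\<close>.\<close>
  have "((\<lambda>t. (complex_of_real l * log_mean s (t powr l) - log_mean s t) / complex_of_real (l - 1) - A)
      \<longlongrightarrow> (complex_of_real l * A - A) / complex_of_real (l - 1) - A) at_top"
    using l0 by (intro tendsto_intros \<tau> \<tau>l)
  also have "(complex_of_real l * A - A) / complex_of_real (l - 1) - A = 0"
    using l0 by (simp add: field_simps)
  finally show ?thesis
    by (rule Lim_transform_eventually)
      \<comment> \<open>The exact formula is available only for \<open>t > 1\<close>, which holds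
        eventually.\<close>
      (use eventually_gt_at_top[of 1] in eventually_elim, subst log_average_diff_eq[OF s _ l], simp_all)
qed

theorem theorem2:
  fixes s :: "real \<Rightarrow> complex" and A :: complex
  assumes "s \<in> L_loc"
    and "summable_L1 s A"
  shows "(s \<longlongrightarrow> A) at_top \<longleftrightarrow>
    Liminf (at_right (1::real)) (\<lambda>l. Limsup at_top (\<lambda>t::real.
      ereal (cmod (complex_of_real (1 / ((l - 1) * ln t)) *
        (LINT u:{t..t powr l}|lebesgue. (s u - s t) / complex_of_real u))))) = 0"
    (is "_ \<longleftrightarrow> Liminf _ ?L = 0")
proof -
  let ?c = "Limsup at_top (\<lambda>t. ereal (cmod (A - s t)))"
  have "?L l = ?c" if "l > 1" for l
    by (intro Limsup_norm_eq_of_diff_tendsto_0 log_average_diff_tendsto assms that) simp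
  \<comment> \<open>The filter \<open>at_right 1\<close> sees only \<open>l > 1\<close>, where
    \<open>?L\<close> has the constant value \<open>?c\<close>.\<close>
  then have "Liminf (at_right 1) ?L = Liminf (at_right (1::real)) (\<lambda>_. ?c)"
    by (intro Liminf_eq eventually_at_right_less[THEN eventually_mono])
  also have "\<dots> = ?c"
    by (rule Liminf_const) simp
  finally have "Liminf (at_right 1) ?L = 0 \<longleftrightarrow> ((\<lambda>t. A - s t) \<longlongrightarrow> 0) at_top"
    by (simp add: Limsup_norm_eq_0_iff)
  also have "\<dots> \<longleftrightarrow> (s \<longlongrightarrow> A) at_top"
    using tendsto_minus_cancel_left[of "\<lambda>t. s t - A" 0] by (simp add: LIM_zero_iff)
  finally show ?thesis by simp
qed

end
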